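(* Suppose $n$ is a positive rational number and $t\ge -1$ is an integer. Then for any point $P=(\theta_t-1,y)\in E_n(K_t)$, $$\operatorname{Tr}(P)\notin E_n[2]\setminus\{O\}.$$
   Context: For an integer $t\ge -1$, let $g_t(X)=X^3-tX^2-(t+3)X-1$, let $\theta_t$ be the largest real root of $g_t$, and let $K_t=\mathbb{Q}(\theta_t)$. The polynomial $g_t$ is irreducible over $\mathbb{Q}$ with three real roots, and $K_t/\mathbb{Q}$ is a cyclic cubic extension; let $\sigma$ be the generator of $\operatorname{Gal}(K_t/\mathbb{Q})$ with $\sigma(\theta_t)=-1/(\theta_t+1)$. For a positive rational number $n$, $E_n$ is the elliptic curve $y^2=x^3-n^2x$ over $\mathbb{Q}$, with identity element $O$, and $E_n[2]=\{O,(0,0),(n,0),(-n,0)\}$ is the subgroup killed by multiplication by two. For $P\in E_n(K_t)$, the trace is $\operatorname{Tr}(P)=P+\sigma P+\sigma^2P\in E_n(\mathbb{Q})$ (sum in the group law of $E_n$). *)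

theory Defs
  imports
    "HOL-Algebra.Generated_Fields"
    "HOL-Algebra.QuotRing"
    "HOL-Algebra.Algebraic_Closure_Type"
    "HOL-Computational_Algebra.Polynomial"
begin

section \<open>The simplest cubic fields\<close>

definition cubic :: "int \<Rightarrow> real poly" where
  "cubic t = [:- 1, - (of_int t + 3), - of_int t, 1:]"

lemma poly_cubic:
  "poly (cubic t) x = x ^ 3 - of_int t * x ^ 2 - (of_int t + 3) * x - 1"
  by (simp add: cubic_def algebra_simps power2_eq_square power3_eq_cube)

definition theta :: "int \<Rightarrow> real" where
  "theta t = Max {x. poly (cubic t) x = 0}"

lemma theta_root: "poly (cubic t) (theta t) = 0"
  and theta_largest: "poly (cubic t) x = 0 \<Longrightarrow> x \<le> theta t"
proof -
  have fin: "finite {x. poly (cubic t) x = 0}"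
    by (rule poly_roots_finite) (simp add: cubic_def)
  have "0 < lead_coeff (cubic t)" by (simp add: cubic_def)
  then obtain b where b: "\<And>x. b \<le> x \<Longrightarrow> lead_coeff (cubic t) \<le> poly (cubic t) x"
    using poly_pinfty_gt_lc by blast
  have "poly (cubic t) (max b 1) > 0"
    using b[of "max b 1"] \<open>0 < lead_coeff (cubic t)\<close> by simp
  moreover have "poly (cubic t) 0 < 0" by (simp add: cubic_def)
  ultimately obtain z where "poly (cubic t) z = 0"
    using poly_IVT_pos[of 0 "max b 1" "cubic t"] by (auto simp: less_max_iff_disj)
  hence ne: "{x. poly (cubic t) x = 0} \<noteq> {}" by blast
  show "poly (cubic t) (theta t) = 0"
    using Max_in[OF fin ne] by (simp add: theta_def)
  show "x \<le> theta t" if "poly (cubic t) x = 0"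
    using that Max_ge[OF fin] by (simp add: theta_def)
qed

abbreviation real_ring :: "real ring" where
  "real_ring \<equiv> ring_of_type_algebra"

text \<open>The subfield of the reals generated by \<open>theta t\<close>; it contains \<open>\<rat>\<close> automatically.\<close>

definition cubic_field :: "int \<Rightarrow> real set" where
  "cubic_field t = generate_field real_ring {theta t}"

text \<open>The elements of \<open>Gal(F/\<rat>)\<close> for a subfield \<open>F\<close> of the reals. They are total functions
  on \<open>real\<close>, of which only the values on \<open>F\<close> matter.\<close>

definition galois_group :: "real set \<Rightarrow> (real \<Rightarrow> real) set" where
  "galois_group F =
     {\<sigma> \<in> ring_iso (real_ring\<lparr>carrier := F\<rparr>) (real_ring\<lparr>carrier := F\<rparr>). \<forall>q\<in>\<rat>. \<sigma> q = q}"


section \<open>The curve \<open>y\<^sup>2 = x\<^sup>3 - n\<^sup>2 x\<close> and its group law\<close>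

datatype 'a ec_point = Infinity | Affine 'a 'a

definition curve :: "real \<Rightarrow> real set \<Rightarrow> real ec_point set" where
  "curve n F = insert Infinity {Affine x y | x y. x \<in> F \<and> y \<in> F \<and> y ^ 2 = x ^ 3 - n ^ 2 * x}"

text \<open>Chord-tangent addition. On the curve, two affine points with the same abscissa are
  either opposite, or equal with nonzero ordinate, in which case the tangent slope is used.\<close>

fun ec_add :: "real \<Rightarrow> real ec_point \<Rightarrow> real ec_point \<Rightarrow> real ec_point" where
  "ec_add n Infinity Q = Q"
| "ec_add n (Affine x1 y1) Infinity = Affine x1 y1"
| "ec_add n (Affine x1 y1) (Affine x2 y2) =
     (if x1 = x2 \<and> y1 = - y2 then Infinity
      else let l = (if x1 = x2 then (3 * x1 ^ 2 - n ^ 2) / (2 * y1) else (y2 - y1) / (x2 - x1));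
               x3 = l ^ 2 - x1 - x2
           in Affine x3 (l * (x1 - x3) - y1))"

definition two_torsion :: "real \<Rightarrow> real ec_point set" where
  "two_torsion n = {Infinity, Affine 0 0, Affine n 0, Affine (- n) 0}"

lemma two_torsion_eq: "two_torsion n = {P \<in> curve n UNIV. ec_add n P P = Infinity}"
proof -
  have fac: "x ^ 3 - n ^ 2 * x = x * (x - n) * (x + n)" for x :: real
    by (simp add: algebra_simps power2_eq_square power3_eq_cube)
  have "P \<in> two_torsion n \<longleftrightarrow> P \<in> curve n UNIV \<and> ec_add n P P = Infinity" for P
    by (cases P) (auto simp: two_torsion_def curve_def fac Let_def)
  thus ?thesis by blast
qed

text \<open>The datatype map \<open>map_ec_point\<close> is the coordinatewise action of an automorphism.\<close>

definition point_trace :: "real \<Rightarrow> (real \<Rightarrow> real) \<Rightarrow> real ec_point \<Rightarrow> real ec_point" where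
  "point_trace n \<sigma> P =
     ec_add n (ec_add n P (map_ec_point \<sigma> P)) (map_ec_point \<sigma> (map_ec_point \<sigma> P))"

end

theory Submission
  imports Defs
begin

text \<open>
  Write \<open>g\<close> for the polynomial \<open>cubic t\<close>, \<open>\<theta>\<^sub>0, \<theta>\<^sub>1, \<theta>\<^sub>2\<close> for its roots
  \<open>\<theta>, \<sigma> \<theta>, \<sigma> (\<sigma> \<theta>)\<close>, and \<open>x\<^sub>i = \<theta>\<^sub>i - 1\<close> for the abscissae of the three conjugates of
  \<open>P\<close>, so that the product of the \<open>z - x\<^sub>i\<close> is \<open>g (z + 1)\<close>.

  Suppose that the trace is a point \<open>T = (e, 0)\<close> of order two. Then the conjugates of \<open>P\<close> together
  with \<open>T = - T\<close> sum to zero, hence they are the zeros of a function whose only pole, of order four,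
  is at infinity. Such a function is \<open>(z - e) (z - d) - c y\<close> up to scaling, the polynomial in \<open>z\<close> being
  divisible by \<open>z - e\<close> since \<open>T\<close> has ordinate zero. Taking norms, with \<open>e'\<close> and \<open>e''\<close> the
  other two abscissae of points of order two,
  \<open>(z - e) (z - d)\<^sup>2 - c\<^sup>2 (z - e') (z - e'') = g (z + 1)\<close>.
  Only the values of this identity at the points of order two are needed. Lemma
  \<open>three_points_sum_two_torsion\<close> derives them from the chord-tangent formulas: at \<open>z = e\<close> it
  gives \<open>- c\<^sup>2 (3 e\<^sup>2 - n\<^sup>2) = g (e + 1)\<close> and at \<open>z = e'\<close> it gives
  \<open>(e' - e) (e' - d)\<^sup>2 = g (e' + 1)\<close>.

  Since \<open>g 1 = - (2 t + 3) < 0\<close>, the value at \<open>z = 0\<close> has the wrong sign when \<open>e = 0\<close> or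
  \<open>e = - n\<close>. When \<open>e = n\<close>, one obtains \<open>n d\<^sup>2 = 2 t + 3\<close> and \<open>2 n\<^sup>2 c\<^sup>2 = - g (n + 1)\<close>. Here
  \<open>c\<close> and \<open>d\<close> are rational: they lie in the cubic field and have rational squares
  (\<open>square_rat_imp_rat\<close>). But writing \<open>d = q / p\<close> in lowest terms and substituting
  \<open>n = (2 t + 3) p\<^sup>2 / q\<^sup>2\<close> turns \<open>- 2 q\<^sup>6 g (n + 1) = (2 n c q\<^sup>3)\<^sup>2\<close> into an integer that is
  twice an odd number, whereas it is a rational square (\<open>two_descent_obstruction\<close>).
\<close>

section \<open>Parity obstructions\<close>

lemma rat_square_int_even_dvd_4:
  fixes r :: real and k :: int
  assumes "r \<in> \<rat>" and "r ^ 2 = of_int k" and "even k"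
  shows "4 dvd k"
proof -
  from \<open>r \<in> \<rat>\<close> obtain a b :: int where ab: "b > 0" "coprime a b" "r = of_int a / of_int b"
    by (rule Rats_cases')
  have "(of_int a :: real) ^ 2 = of_int k * of_int b ^ 2"
    using assms(2) ab by (simp add: power_divide field_simps)
  hence eq: "a ^ 2 = k * b ^ 2"
    by (metis of_int_eq_iff of_int_mult of_int_power)
  hence "even a" using \<open>even k\<close> by (metis even_mult_iff even_power pos2)
  hence "odd b" using ab(2) by (auto simp: coprime_common_divisor)
  have "2 ^ 2 dvd a ^ 2" using \<open>even a\<close> by (simp only: dvd_power_same)
  hence "4 dvd k * b ^ 2" using eq by simp
  moreover have "coprime (2 ^ 2) (b ^ 2)" using \<open>odd b\<close>
    by (simp only: coprime_power_left_iff coprime_power_right_iff coprime_left_2_iff_odd) simp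
  ultimately show ?thesis by (simp add: coprime_dvd_mult_left_iff)
qed

lemma cubic_root_irrational:
  assumes "poly (cubic t) x = 0"
  shows "x \<notin> \<rat>"
proof
  assume "x \<in> \<rat>"
  then obtain p q :: int where pq: "q > 0" "coprime p q" "x = of_int p / of_int q"
    by (rule Rats_cases')
  have "of_int p = x * of_int q" using pq by simp
  hence "of_int (p ^ 3 - t * p ^ 2 * q - (t + 3) * p * q ^ 2 - q ^ 3) =
      poly (cubic t) x * of_int q ^ 3"
    by (simp add: poly_cubic algebra_simps power2_eq_square power3_eq_cube)
  hence "(of_int (p ^ 3 - t * p ^ 2 * q - (t + 3) * p * q ^ 2 - q ^ 3) :: real) = 0"
    using assms by simp
  hence "p ^ 3 - t * p ^ 2 * q - (t + 3) * p * q ^ 2 - q ^ 3 = 0"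
    by (simp only: of_int_eq_0_iff)
  \<comment> \<open>The cubic form has no nontrivial zero modulo 2, whatever the parity of \<open>t\<close>.\<close>
  hence "even (p ^ 3 - t * p ^ 2 * q - (t + 3) * p * q ^ 2 - q ^ 3)" by simp
  moreover have "\<not> (even p \<and> even q)" using pq(2) by (auto simp: coprime_common_divisor)
  ultimately show False by auto
qed

text \<open>The right-hand sides are \<open>- g 1\<close> and \<open>- g (n + 1)\<close>; the obstruction is 2-adic.\<close>

lemma two_descent_obstruction:
  fixes n c d :: real and t :: int
  assumes "c \<in> \<rat>" "d \<in> \<rat>"
    and nd: "n * d ^ 2 = 2 * of_int t + 3"
    and nc: "2 * n ^ 2 * c ^ 2 = - poly (cubic t) (n + 1)"
  shows False
proof -
  define m where "m = 2 * t + 3"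
  have "m \<noteq> 0" by (auto simp: m_def) presburger
  have nd': "n * d ^ 2 = of_int m" using nd by (simp add: m_def)
  have "d \<noteq> 0" using nd' \<open>m \<noteq> 0\<close> by auto
  from \<open>d \<in> \<rat>\<close> obtain q p :: int where pq: "p > 0" "coprime q p" "d = of_int q / of_int p"
    by (rule Rats_cases')
  have "q \<noteq> 0" using pq \<open>d \<noteq> 0\<close> by auto
  have n: "n = of_int m * of_int p ^ 2 / of_int q ^ 2"
    using nd' pq \<open>q \<noteq> 0\<close> by (simp add: field_simps)
  hence nq: "n * of_int q ^ 2 = of_int m * of_int p ^ 2" using \<open>q \<noteq> 0\<close> by simp
  \<comment> \<open>Modulo 2, \<open>h\<close> is \<open>q + p q + p\<close>, which vanishes only if both \<open>p\<close> and \<open>q\<close> do.\<close>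
  define h where "h = m * q ^ 6 + 3 * t * m * p ^ 2 * q ^ 4 - (3 - t) * m ^ 2 * p ^ 4 * q ^ 2
    - m ^ 3 * p ^ 6"
  have "(2 * n * c) ^ 2 = 2 * (2 * n ^ 2 * c ^ 2)"
    by (simp add: power_mult_distrib)
  also have "\<dots> = - 2 * poly (cubic t) (n + 1)"
    unfolding nc by simp
  also have "\<dots> = 2 * of_int m + 6 * of_int t * n - 2 * (3 - of_int t) * n ^ 2 - 2 * n ^ 3"
    by (simp add: poly_cubic m_def algebra_simps power2_eq_square power3_eq_cube)
  finally have "(2 * n * c * of_int q ^ 3) ^ 2 =
      (2 * of_int m + 6 * of_int t * n - 2 * (3 - of_int t) * n ^ 2 - 2 * n ^ 3) * of_int q ^ 6"
    by (simp add: power_mult_distrib)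
  also have "\<dots> = 2 * of_int m * of_int q ^ 6 + 6 * of_int t * (n * of_int q ^ 2) * of_int q ^ 4
      - 2 * (3 - of_int t) * (n * of_int q ^ 2) ^ 2 * of_int q ^ 2 - 2 * (n * of_int q ^ 2) ^ 3"
    by (simp add: eval_nat_numeral algebra_simps)
  also have "\<dots> = of_int (2 * h)"
    unfolding nq h_def by (simp add: eval_nat_numeral algebra_simps)
  finally have sq: "(2 * n * c * of_int q ^ 3) ^ 2 = of_int (2 * h)" .
  have "n \<in> \<rat>" unfolding n by simp
  hence "2 * n * c * of_int q ^ 3 \<in> \<rat>" using \<open>c \<in> \<rat>\<close> by simp
  from rat_square_int_even_dvd_4[OF this sq] have "even h" by presburger
  moreover have "odd m" by (simp add: m_def)
  moreover have "\<not> (even p \<and> even q)" using pq(2) by (auto simp: coprime_common_divisor)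
  ultimately show False unfolding h_def by auto
qed

section \<open>A sum of three points equal to a point of order two\<close>

text \<open>The chord with slope \<open>l\<close> meets the curve in a third point, with abscissa \<open>x3\<close>.\<close>

lemma line_meets_curve:
  fixes n x0 y0 x1 y1 z :: real
  assumes "x0 \<noteq> x1" and "y0 ^ 2 = x0 ^ 3 - n ^ 2 * x0" and "y1 ^ 2 = x1 ^ 3 - n ^ 2 * x1"
    and l: "l = (y1 - y0) / (x1 - x0)" and x3: "x3 = l ^ 2 - x0 - x1"
  shows "z ^ 3 - n ^ 2 * z - (l * (z - x0) + y0) ^ 2 = (z - x0) * (z - x1) * (z - x3)"
proof -
  define A where "A = - (n ^ 2) + 2 * l * (l * x0 - y0) - (x0 * x1 + x0 * x3 + x1 * x3)"
  define B where "B = x0 * x1 * x3 - (l * x0 - y0) ^ 2"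
  \<comment> \<open>The difference of the two sides is linear in \<open>z\<close> and vanishes at \<open>x0\<close> and \<open>x1\<close>.\<close>
  have key: "z ^ 3 - n ^ 2 * z - (l * (z - x0) + y0) ^ 2 - (z - x0) * (z - x1) * (z - x3) =
      A * z + B" for z
    unfolding A_def B_def x3 by (simp add: algebra_simps power2_eq_square power3_eq_cube)
  have y1: "l * (x1 - x0) + y0 = y1" using l \<open>x0 \<noteq> x1\<close> by (simp add: field_simps)
  have "A * x0 + B = 0" using key[of x0] assms(2) by simp
  moreover have "A * x1 + B = 0" using key[of x1] assms(3) y1 by simp
  moreover have "A * (x0 - x1) = (A * x0 + B) - (A * x1 + B)" by (simp add: algebra_simps)
  ultimately have "A * (x0 - x1) = 0" by simp
  hence "A = 0" "B = 0" using \<open>x0 \<noteq> x1\<close> \<open>A * x0 + B = 0\<close> by auto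
  thus ?thesis using key[of z] by simp
qed

text \<open>If \<open>(a, b)\<close> and \<open>(x\<^sub>2, y\<^sub>2)\<close> sum to \<open>(e, 0)\<close>, then the line through them, which is
  their common tangent if they coincide, passes through \<open>(e, 0)\<close> as well. Its slope is therefore
  \<open>y\<^sub>2 / (x\<^sub>2 - e)\<close> in both cases of the addition law.\<close>

lemma ec_add_eq_ordinate_zeroD:
  fixes n a b x2 y2 e :: real
  assumes sum: "ec_add n (Affine a b) (Affine x2 y2) = Affine e 0"
    and "y2 ^ 2 = x2 ^ 3 - n ^ 2 * x2" and "b ^ 2 = a ^ 3 - n ^ 2 * a" and "x2 \<noteq> e"
  shows "b = y2 / (x2 - e) * (a - e)" and "(y2 / (x2 - e)) ^ 2 = a + x2 + e"
proof -
  have nopp: "\<not> (a = x2 \<and> b = - y2)" using sum by auto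
  define l where "l = (if a = x2 then (3 * a ^ 2 - n ^ 2) / (2 * b) else (y2 - b) / (x2 - a))"
  have "e = l ^ 2 - a - x2" and "l * (a - e) = b"
    using sum nopp by (auto simp: Let_def l_def split: if_splits)
  have "y2 = l * (x2 - e)"
  proof (cases "a = x2")
    case True
    hence "b ^ 2 = y2 ^ 2" using assms by simp
    hence "y2 = b" using nopp True by (auto simp: power2_eq_iff)
    thus ?thesis using True \<open>l * (a - e) = b\<close> by simp
  next
    case False
    hence "l * (x2 - a) = y2 - b" by (simp add: l_def)
    thus ?thesis using \<open>l * (a - e) = b\<close> by (simp add: algebra_simps)
  qed
  hence "y2 / (x2 - e) = l" using \<open>x2 \<noteq> e\<close> by simp
  thus "b = y2 / (x2 - e) * (a - e)" and "(y2 / (x2 - e)) ^ 2 = a + x2 + e"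
    using \<open>l * (a - e) = b\<close> \<open>e = l ^ 2 - a - x2\<close> by simp_all
qed

text \<open>Let \<open>l\<close> be the slope of the line \<open>y = L z\<close> through the first two points,
  \<open>L z = l (z - x\<^sub>0) + y\<^sub>0\<close>, and \<open>m\<close> that of the line \<open>y = m (z - e)\<close> through the third point
  and the point of order two. The two lines meet the line \<open>z = x\<^sub>3\<close> in opposite points of the curve,
  and the function with the zeros wanted is \<open>(y - L z) (y - m (z - e)) / (z - x\<^sub>3)\<close>. Its coefficient
  of \<open>- y\<close> is \<open>l + m\<close>. Its part free of \<open>y\<close>, divided by \<open>z - e\<close>, takes the value \<open>d\<close>
  at \<open>z = e'\<close>. The assumption \<open>3 e\<^sup>2 \<noteq> n\<^sup>2\<close> says that \<open>e\<close> is a simple root.\<close>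

lemma three_points_sum_two_torsion:
  fixes n e e' x0 y0 x1 y1 x2 y2 :: real
  assumes on: "y0 ^ 2 = x0 ^ 3 - n ^ 2 * x0" "y1 ^ 2 = x1 ^ 3 - n ^ 2 * x1" "y2 ^ 2 = x2 ^ 3 - n ^ 2 * x2"
    and "x0 \<noteq> x1" and "x2 ^ 3 \<noteq> n ^ 2 * x2"
    and e: "e ^ 3 = n ^ 2 * e" "3 * e ^ 2 \<noteq> n ^ 2" and e': "e' ^ 3 = n ^ 2 * e'" "e' \<noteq> e"
    and sum: "ec_add n (ec_add n (Affine x0 y0) (Affine x1 y1)) (Affine x2 y2) = Affine e 0"
    and l: "l = (y1 - y0) / (x1 - x0)" and m: "m = y2 / (x2 - e)"
    and x3: "x3 = l ^ 2 - x0 - x1"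
    and d: "d = (l * (e' - x0) + y0) * m / (e' - x3)"
  shows "(l + m) ^ 2 * (3 * e ^ 2 - n ^ 2) = - ((e - x0) * (e - x1) * (e - x2))"
    and "d ^ 2 * (e' - e) = (e' - x0) * (e' - x1) * (e' - x2)"
proof -
  define b where "b = l * (x0 - x3) - y0"
  note line = line_meets_curve[OF \<open>x0 \<noteq> x1\<close> on(1,2) l x3]
  \<comment> \<open>\<open>(x3, b)\<close> is the sum of the first two points.\<close>
  have sum': "ec_add n (Affine x3 b) (Affine x2 y2) = Affine e 0"
    using sum \<open>x0 \<noteq> x1\<close> by (simp add: Let_def l x3 b_def)
  have b2: "b ^ 2 = x3 ^ 3 - n ^ 2 * x3"
    using line[of x3] by (simp add: b_def power2_eq_square algebra_simps)
  have "x2 \<noteq> e" using e(1) \<open>x2 ^ 3 \<noteq> _\<close> by auto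
  have b: "b = m * (x3 - e)" and m2: "m ^ 2 = x3 + x2 + e"
    using ec_add_eq_ordinate_zeroD[OF sum' on(3) b2 \<open>x2 \<noteq> e\<close>] by (simp_all add: m)
  have y2: "y2 = m * (x2 - e)" using \<open>x2 \<noteq> e\<close> by (simp add: m)
  have "(m * (x2 - e)) ^ 2 = (x2 - e) * (x2 ^ 2 + e * x2 + e ^ 2 - n ^ 2)"
    using on(3) e(1) unfolding y2 by (simp add: algebra_simps power2_eq_square power3_eq_cube)
  hence "(x2 - e) * (m ^ 2 * (x2 - e)) = (x2 - e) * (x2 ^ 2 + e * x2 + e ^ 2 - n ^ 2)"
    by (simp add: power_mult_distrib power2_eq_square mult_ac)
  hence "m ^ 2 * (x2 - e) = x2 ^ 2 + e * x2 + e ^ 2 - n ^ 2"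
    using \<open>x2 \<noteq> e\<close> by simp
  hence "(x3 + x2 + e) * (x2 - e) = x2 ^ 2 + e * x2 + e ^ 2 - n ^ 2"
    by (simp add: m2)
  \<comment> \<open>The line of slope \<open>m\<close> meets the curve at the abscissae \<open>e\<close>, \<open>x2\<close> and \<open>x3\<close>; here the factor
    \<open>z - e\<close> is divided out.\<close>
  hence line': "z ^ 2 + e * z + e ^ 2 - n ^ 2 - m ^ 2 * (z - e) = (z - x2) * (z - x3)" for z
    unfolding m2 by (simp add: algebra_simps power2_eq_square)
  have qe: "3 * e ^ 2 - n ^ 2 = (e - x2) * (e - x3)"
    using line'[of e] by (simp add: power2_eq_square)
  hence "e \<noteq> x3" using e(2) by auto
  have "l * (e - x0) + y0 = (l + m) * (e - x3)"
    using b by (simp add: b_def algebra_simps)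
  hence "- (((l + m) * (e - x3)) ^ 2) = (e - x0) * (e - x1) * (e - x3)"
    using line[of e] e(1) by simp
  hence "(e - x3) * ((l + m) ^ 2 * (e - x3)) = (e - x3) * (- ((e - x0) * (e - x1)))"
    by (simp add: power_mult_distrib power2_eq_square algebra_simps)
  hence "(l + m) ^ 2 * (e - x3) = - ((e - x0) * (e - x1))"
    using \<open>e \<noteq> x3\<close> by (metis mult_left_cancel right_minus_eq)
  thus "(l + m) ^ 2 * (3 * e ^ 2 - n ^ 2) = - ((e - x0) * (e - x1) * (e - x2))"
    unfolding qe by (simp add: mult.assoc mult.left_commute[of _ "e - x2"])
  have "(e' - e) * (e' ^ 2 + e * e' + e ^ 2 - n ^ 2) = (e' ^ 3 - n ^ 2 * e') - (e ^ 3 - n ^ 2 * e)"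
    by (simp add: algebra_simps power2_eq_square power3_eq_cube)
  hence "(e' - e) * (e' ^ 2 + e * e' + e ^ 2 - n ^ 2) = 0" using e(1) e'(1) by simp
  hence q0: "e' ^ 2 + e * e' + e ^ 2 - n ^ 2 = 0" using e'(2) by simp
  have me: "m ^ 2 * (e' - e) = - ((e' - x2) * (e' - x3))"
    using line'[of e'] q0 by simp
  \<comment> \<open>Otherwise the third point would have order two.\<close>
  have "e' \<noteq> x3"
  proof
    assume "e' = x3"
    hence "m = 0" using me e'(2) by simp
    hence "y2 = 0" using y2 by simp
    thus False using on(3) \<open>x2 ^ 3 \<noteq> _\<close> by simp
  qed
  have L2: "(l * (e' - x0) + y0) ^ 2 = - ((e' - x0) * (e' - x1) * (e' - x3))"
    using line[of e'] e'(1) by simp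
  have "d ^ 2 * (e' - e) = (l * (e' - x0) + y0) ^ 2 * (m ^ 2 * (e' - e)) / (e' - x3) ^ 2"
    by (simp add: d power_divide power_mult_distrib)
  also have "\<dots> = (e' - x0) * (e' - x1) * (e' - x2)"
    unfolding L2 me using \<open>e' \<noteq> x3\<close> by (simp add: power2_eq_square)
  finally show "d ^ 2 * (e' - e) = (e' - x0) * (e' - x1) * (e' - x2)" .
qed

section \<open>The cyclic action on the cubic field\<close>

lemma real_ring_simps [simp]:
  "carrier real_ring = UNIV" "x \<otimes>\<^bsub>real_ring\<^esub> y = x * y" "x \<oplus>\<^bsub>real_ring\<^esub> y = x + y"
  "\<one>\<^bsub>real_ring\<^esub> = 1" "\<zero>\<^bsub>real_ring\<^esub> = 0"
  by (simp_all add: ring_of_type_algebra_def)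

lemma real_ring_a_inv [simp]: "\<ominus>\<^bsub>real_ring\<^esub> x = - x"
proof -
  interpret field real_ring by (rule field_from_type_algebra)
  show ?thesis using minus_equality[of "- x" x] by simp
qed

lemma real_ring_m_inv [simp]: "x \<noteq> 0 \<Longrightarrow> inv\<^bsub>real_ring\<^esub> x = inverse x"
proof -
  assume "x \<noteq> 0"
  interpret field real_ring by (rule field_from_type_algebra)
  show ?thesis using comm_inv_char[of x "inverse x"] \<open>x \<noteq> 0\<close> by simp
qed

lemma cubic_field_closed:
  shows "theta t \<in> cubic_field t" and "1 \<in> cubic_field t"
    and "x \<in> cubic_field t \<Longrightarrow> - x \<in> cubic_field t"
    and "x \<in> cubic_field t \<Longrightarrow> inverse x \<in> cubic_field t"
    and "x \<in> cubic_field t \<Longrightarrow> y \<in> cubic_field t \<Longrightarrow> x + y \<in> cubic_field t"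
    and "x \<in> cubic_field t \<Longrightarrow> y \<in> cubic_field t \<Longrightarrow> x * y \<in> cubic_field t"
    and "x \<in> cubic_field t \<Longrightarrow> y \<in> cubic_field t \<Longrightarrow> x - y \<in> cubic_field t"
    and "x \<in> cubic_field t \<Longrightarrow> y \<in> cubic_field t \<Longrightarrow> x / y \<in> cubic_field t"
    and "x \<in> cubic_field t \<Longrightarrow> x ^ k \<in> cubic_field t"
    and "q \<in> \<rat> \<Longrightarrow> q \<in> cubic_field t"
proof -
  note rules = generate_field.intros[where R = real_ring and H = "{theta t}", folded cubic_field_def]
  show "theta t \<in> cubic_field t" using rules(2) by simp
  show one: "1 \<in> cubic_field t" using rules(1) by simp
  show neg: "x \<in> cubic_field t \<Longrightarrow> - x \<in> cubic_field t" for x using rules(3)[of x] by simp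
  show add: "x \<in> cubic_field t \<Longrightarrow> y \<in> cubic_field t \<Longrightarrow> x + y \<in> cubic_field t" for x y
    using rules(5)[of x y] by simp
  show mult: "x \<in> cubic_field t \<Longrightarrow> y \<in> cubic_field t \<Longrightarrow> x * y \<in> cubic_field t" for x y
    using rules(6)[of x y] by simp
  have zero: "0 \<in> cubic_field t" using add[OF one neg[OF one]] by simp
  show inverse: "x \<in> cubic_field t \<Longrightarrow> inverse x \<in> cubic_field t" for x
    using rules(4)[of x] zero by (cases "x = 0") simp_all
  show "x \<in> cubic_field t \<Longrightarrow> y \<in> cubic_field t \<Longrightarrow> x - y \<in> cubic_field t"
    using add[OF _ neg, of x y] by simp
  show divide: "x \<in> cubic_field t \<Longrightarrow> y \<in> cubic_field t \<Longrightarrow> x / y \<in> cubic_field t" for x y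
    using mult[OF _ inverse, of x y] by (simp add: divide_inverse)
  show "x \<in> cubic_field t \<Longrightarrow> x ^ k \<in> cubic_field t"
    by (induction k) (simp_all add: one mult)
  have nat: "of_nat i \<in> cubic_field t" for i
    by (induction i) (simp_all add: zero one add)
  have int: "of_int i \<in> cubic_field t" for i
    by (cases i rule: int_cases) (simp_all add: nat neg one add flip: of_nat_Suc del: of_nat_Suc)
  show "q \<in> cubic_field t" if "q \<in> \<rat>"
    using that by (elim Rats_cases') (simp add: divide int)
qed

text \<open>The generator of the Galois group of the cubic field that is determined by its value
  at \<open>theta t\<close>.\<close>

locale cyclic_cubic =
  fixes t :: int and \<sigma> :: "real \<Rightarrow> real"
  assumes galois: "\<sigma> \<in> galois_group (cubic_field t)"
    and sigma_theta: "\<sigma> (theta t) = - 1 / (theta t + 1)"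
begin

abbreviation "K \<equiv> cubic_field t"
abbreviation "\<theta> \<equiv> theta t"

lemma sigma:
  shows sigma_in: "x \<in> K \<Longrightarrow> \<sigma> x \<in> K"
    and sigma_add: "x \<in> K \<Longrightarrow> y \<in> K \<Longrightarrow> \<sigma> (x + y) = \<sigma> x + \<sigma> y"
    and sigma_mult: "x \<in> K \<Longrightarrow> y \<in> K \<Longrightarrow> \<sigma> (x * y) = \<sigma> x * \<sigma> y"
    and sigma_rat: "q \<in> \<rat> \<Longrightarrow> \<sigma> q = q"
    and sigma_inj: "inj_on \<sigma> K"
proof -
  have hom: "\<sigma> \<in> ring_hom (real_ring\<lparr>carrier := K\<rparr>) (real_ring\<lparr>carrier := K\<rparr>)"
    and "bij_betw \<sigma> K K" and "\<forall>q\<in>\<rat>. \<sigma> q = q"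
    using galois by (auto simp: galois_group_def ring_iso_def)
  thus "inj_on \<sigma> K" "q \<in> \<rat> \<Longrightarrow> \<sigma> q = q" by (auto simp: bij_betw_def)
  show "x \<in> K \<Longrightarrow> \<sigma> x \<in> K" "x \<in> K \<Longrightarrow> y \<in> K \<Longrightarrow> \<sigma> (x + y) = \<sigma> x + \<sigma> y"
     "x \<in> K \<Longrightarrow> y \<in> K \<Longrightarrow> \<sigma> (x * y) = \<sigma> x * \<sigma> y"
    using ring_hom_memE(1,2,3)[OF hom] by auto
qed

lemma sigma_uminus: "x \<in> K \<Longrightarrow> \<sigma> (- x) = - \<sigma> x"
  using sigma_mult[of "- 1" x] sigma_rat[of "- 1"] cubic_field_closed(10)[of "- 1" t] by simp

lemma sigma_diff: "x \<in> K \<Longrightarrow> y \<in> K \<Longrightarrow> \<sigma> (x - y) = \<sigma> x - \<sigma> y"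
  using sigma_add[of x "- y"] sigma_uminus[of y] cubic_field_closed(3) by simp

lemma sigma_power: "x \<in> K \<Longrightarrow> \<sigma> (x ^ k) = \<sigma> x ^ k"
  by (induction k) (simp_all add: sigma_rat sigma_mult cubic_field_closed)

lemma sigma_eq_0_iff: "x \<in> K \<Longrightarrow> \<sigma> x = 0 \<longleftrightarrow> x = 0"
  using inj_onD[OF sigma_inj, of x 0] sigma_rat[of 0] cubic_field_closed(10)[of 0 t] by auto

lemma theta_nonzero: "\<theta> \<noteq> 0" "\<theta> + 1 \<noteq> 0"
proof -
  have "\<theta> \<notin> \<rat>" by (rule cubic_root_irrational[OF theta_root])
  moreover have "\<theta> = -1" if "\<theta> + 1 = 0" using that by simp
  ultimately show "\<theta> \<noteq> 0" "\<theta> + 1 \<noteq> 0"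
    by (metis Rats_0, metis Rats_minus_iff Rats_1)
qed

lemma theta_cube: "\<theta> ^ 3 = of_int t * \<theta> ^ 2 + (of_int t + 3) * \<theta> + 1"
  using theta_root[of t] by (simp add: poly_cubic)

lemma theta_inverses:
  "- 1 / (\<theta> + 1) = \<theta> ^ 2 - (of_int t + 1) * \<theta> - 2"
  "- (\<theta> + 1) / \<theta> = - (\<theta> ^ 2) + of_int t * \<theta> + of_int t + 2"
proof -
  have "(\<theta> ^ 2 - (of_int t + 1) * \<theta> - 2) * (\<theta> + 1) = - 1"
    using theta_cube by (simp add: algebra_simps power2_eq_square power3_eq_cube)
  thus "- 1 / (\<theta> + 1) = \<theta> ^ 2 - (of_int t + 1) * \<theta> - 2"
    by (metis nonzero_divide_eq_eq theta_nonzero(2))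
  have "(- (\<theta> ^ 2) + of_int t * \<theta> + of_int t + 2) * \<theta> = - (\<theta> + 1)"
    using theta_cube by (simp add: algebra_simps power2_eq_square power3_eq_cube)
  thus "- (\<theta> + 1) / \<theta> = - (\<theta> ^ 2) + of_int t * \<theta> + of_int t + 2"
    by (metis nonzero_divide_eq_eq theta_nonzero(1))
qed

lemma sigma_inverse: "x \<in> K \<Longrightarrow> \<sigma> (inverse x) = inverse (\<sigma> x)"
proof (cases "x = 0")
  case False
  assume "x \<in> K"
  hence "\<sigma> x * \<sigma> (inverse x) = 1"
    using sigma_mult[of x "inverse x"] sigma_rat[of 1] False cubic_field_closed(4)[of x t] by simp
  thus ?thesis by (metis inverse_unique)
qed (simp add: sigma_rat)

lemma sigma_divide: "x \<in> K \<Longrightarrow> y \<in> K \<Longrightarrow> \<sigma> (x / y) = \<sigma> x / \<sigma> y"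
  using sigma_mult[of x "inverse y"] sigma_inverse[of y] cubic_field_closed(4)[of y t]
  by (simp add: divide_inverse)

lemmas sigma_hom = sigma_add sigma_mult sigma_uminus sigma_diff sigma_power sigma_divide sigma_rat

lemma sigma2_theta: "\<sigma> (\<sigma> \<theta>) = - (\<theta> + 1) / \<theta>"
proof -
  have "\<sigma> (\<sigma> \<theta>) = - 1 / (\<sigma> \<theta> + 1)"
    by (subst sigma_theta) (simp add: sigma_hom cubic_field_closed)
  thus ?thesis unfolding sigma_theta using theta_nonzero by (simp add: divide_simps)
qed

lemma sigma3_theta: "\<sigma> (\<sigma> (\<sigma> \<theta>)) = \<theta>"
proof -
  have "\<sigma> (\<sigma> (\<sigma> \<theta>)) = - (\<sigma> \<theta> + 1) / \<sigma> \<theta>"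
    by (subst sigma2_theta) (simp add: sigma_hom cubic_field_closed)
  thus ?thesis unfolding sigma_theta using theta_nonzero by (simp add: divide_simps)
qed

lemma cubic_factorization:
  "(z - \<theta>) * (z - \<sigma> \<theta>) * (z - \<sigma> (\<sigma> \<theta>)) = poly (cubic t) z"
proof -
  have *: "\<sigma> \<theta> + \<sigma> (\<sigma> \<theta>) = of_int t - \<theta>"
    unfolding sigma2_theta unfolding sigma_theta theta_inverses by (simp add: algebra_simps)
  have **: "\<sigma> \<theta> * \<sigma> (\<sigma> \<theta>) = 1 / \<theta>"
    unfolding sigma2_theta unfolding sigma_theta using theta_nonzero by (simp add: divide_simps)
  have "(\<theta> ^ 2 - of_int t * \<theta> - (of_int t + 3)) * \<theta> =
      \<theta> ^ 3 - of_int t * \<theta> ^ 2 - (of_int t + 3) * \<theta>"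
    by (simp add: algebra_simps power2_eq_square power3_eq_cube)
  hence "(\<theta> ^ 2 - of_int t * \<theta> - (of_int t + 3)) * \<theta> = 1"
    by (simp add: theta_cube)
  hence ***: "1 / \<theta> = \<theta> ^ 2 - of_int t * \<theta> - (of_int t + 3)"
    by (metis nonzero_divide_eq_eq theta_nonzero(1))
  have "(z - \<theta>) * (z - \<sigma> \<theta>) * (z - \<sigma> (\<sigma> \<theta>)) =
      (z - \<theta>) * (z ^ 2 - (\<sigma> \<theta> + \<sigma> (\<sigma> \<theta>)) * z + \<sigma> \<theta> * \<sigma> (\<sigma> \<theta>))"
    by (simp add: algebra_simps power2_eq_square)
  also have "\<dots> = z ^ 3 - of_int t * z ^ 2 - (of_int t + 3) * z
      - (\<theta> ^ 3 - of_int t * \<theta> ^ 2 - (of_int t + 3) * \<theta>)"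
    unfolding * ** *** by (simp add: algebra_simps power2_eq_square power3_eq_cube)
  also have "\<dots> = poly (cubic t) z"
    by (simp add: poly_cubic theta_cube)
  finally show ?thesis .
qed

section \<open>The cubic field as a rational span\<close>

text \<open>The rational span of \<open>1, \<theta>, \<theta>\<^sup>2\<close>. It is shown below to be the whole field.\<close>

definition span_theta :: "real set" where
  "span_theta = {a + b * \<theta> + c * \<theta> ^ 2 | a b c. a \<in> \<rat> \<and> b \<in> \<rat> \<and> c \<in> \<rat>}"

lemma span_thetaI: "a \<in> \<rat> \<Longrightarrow> b \<in> \<rat> \<Longrightarrow> c \<in> \<rat> \<Longrightarrow> w = a + b * \<theta> + c * \<theta> ^ 2 \<Longrightarrow> w \<in> span_theta"
  by (auto simp: span_theta_def)

lemma span_thetaE: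
  assumes "w \<in> span_theta"
  obtains a b c where "a \<in> \<rat>" "b \<in> \<rat>" "c \<in> \<rat>" "w = a + b * \<theta> + c * \<theta> ^ 2"
  using assms by (auto simp: span_theta_def)

lemma span_theta_add: "v \<in> span_theta \<Longrightarrow> w \<in> span_theta \<Longrightarrow> v + w \<in> span_theta"
proof (elim span_thetaE)
  fix a b c a' b' c'
  assume "a \<in> \<rat>" "b \<in> \<rat>" "c \<in> \<rat>" "a' \<in> \<rat>" "b' \<in> \<rat>" "c' \<in> \<rat>"
    "v = a + b * \<theta> + c * \<theta> ^ 2" "w = a' + b' * \<theta> + c' * \<theta> ^ 2"
  thus ?thesis by (intro span_thetaI[of "a + a'" "b + b'" "c + c'"]) (auto simp: algebra_simps)
qed

lemma span_theta_mult: "v \<in> span_theta \<Longrightarrow> w \<in> span_theta \<Longrightarrow> v * w \<in> span_theta"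
proof (elim span_thetaE)
  fix a b c a' b' c'
  assume *: "a \<in> \<rat>" "b \<in> \<rat>" "c \<in> \<rat>" "a' \<in> \<rat>" "b' \<in> \<rat>" "c' \<in> \<rat>"
    "v = a + b * \<theta> + c * \<theta> ^ 2" "w = a' + b' * \<theta> + c' * \<theta> ^ 2"
  let ?p = "b * c' + c * b'" and ?q = "c * c'" and ?t = "of_int t :: real"
  have th4: "\<theta> ^ 4 = ?t + (?t * (?t + 3) + 1) * \<theta> + (?t ^ 2 + ?t + 3) * \<theta> ^ 2"
  proof -
    have "\<theta> ^ 4 = ?t * \<theta> ^ 3 + (?t + 3) * \<theta> ^ 2 + \<theta>"
      using arg_cong[OF theta_cube, of "\<lambda>z. z * \<theta>"]
      by (simp add: algebra_simps power2_eq_square power3_eq_cube power4_eq_xxxx)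
    thus ?thesis unfolding theta_cube by (simp add: algebra_simps power2_eq_square)
  qed
  have "v * w = a * a' + (a * b' + b * a') * \<theta>
      + (a * c' + b * b' + c * a') * \<theta> ^ 2 + ?p * \<theta> ^ 3 + ?q * \<theta> ^ 4"
    unfolding * by (simp add: algebra_simps power2_eq_square power3_eq_cube power4_eq_xxxx)
  also have "\<dots> = (a * a' + ?p + ?q * ?t)
    + (a * b' + b * a' + ?p * (?t + 3) + ?q * (?t * (?t + 3) + 1)) * \<theta>
    + (a * c' + b * b' + c * a' + ?p * ?t + ?q * (?t ^ 2 + ?t + 3)) * \<theta> ^ 2"
    unfolding theta_cube th4 by (simp add: algebra_simps)
  finally show ?thesis using *(1-6) by (intro span_thetaI) auto
qed

lemma span_theta_rat: "q \<in> \<rat> \<Longrightarrow> q \<in> span_theta"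
  by (rule span_thetaI[of q 0 0]) auto

lemma span_theta_in_K: "w \<in> span_theta \<Longrightarrow> w \<in> K"
  by (elim span_thetaE) (simp add: cubic_field_closed)

lemma sigma_span_theta:
  assumes "w \<in> span_theta"
  shows "\<sigma> w \<in> span_theta"
proof -
  from assms obtain a b c where *: "a \<in> \<rat>" "b \<in> \<rat>" "c \<in> \<rat>" "w = a + b * \<theta> + c * \<theta> ^ 2"
    by (rule span_thetaE)
  have "\<sigma> \<theta> \<in> span_theta" unfolding sigma_theta theta_inverses
    by (rule span_thetaI[of "- 2" "- (of_int t + 1)" 1]) (auto simp: algebra_simps)
  moreover have "\<sigma> w = a + b * \<sigma> \<theta> + c * (\<sigma> \<theta> * \<sigma> \<theta>)"
    using * by (simp add: sigma_hom cubic_field_closed power2_eq_square)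
  ultimately show ?thesis using *
    by (auto intro!: span_theta_add span_theta_mult intro: span_theta_rat)
qed

text \<open>The traces of \<open>\<theta>\<close> and \<open>\<theta>\<^sup>2\<close> are rational by the relations between roots and
  coefficients of the cubic. As the trace of a fixed element is three times this element, fixed
  elements are rational; no linear independence of \<open>1, \<theta>, \<theta>\<^sup>2\<close> is needed.\<close>

lemma trace_rat:
  assumes "w \<in> span_theta"
  shows "w + \<sigma> w + \<sigma> (\<sigma> w) \<in> \<rat>"
proof -
  from assms obtain a b c where *: "a \<in> \<rat>" "b \<in> \<rat>" "c \<in> \<rat>" "w = a + b * \<theta> + c * \<theta> ^ 2"
    by (rule span_thetaE)
  have s: "\<sigma> w = a + b * \<sigma> \<theta> + c * \<sigma> \<theta> ^ 2"
    using * by (simp add: sigma_hom cubic_field_closed)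
  have ss: "\<sigma> (\<sigma> w) = a + b * \<sigma> (\<sigma> \<theta>) + c * \<sigma> (\<sigma> \<theta>) ^ 2"
    unfolding s using * by (simp add: sigma_hom cubic_field_closed sigma_in)
  let ?x = \<theta> and ?y = "\<sigma> \<theta>" and ?z = "\<sigma> (\<sigma> \<theta>)"
  have f: "(z - ?x) * (z - ?y) * (z - ?z) = z ^ 3 - of_int t * z ^ 2 - (of_int t + 3) * z - 1" for z
    using cubic_factorization[of z] by (simp add: poly_cubic)
  have e1: "?x + ?y + ?z = of_int t" and e2: "?x * ?y + ?x * ?z + ?y * ?z = - (of_int t + 3)"
    using f[of 0] f[of 1] f[of "-1"] by (simp_all add: algebra_simps)
  have "?x ^ 2 + ?y ^ 2 + ?z ^ 2 = (?x + ?y + ?z) ^ 2 - 2 * (?x * ?y + ?x * ?z + ?y * ?z)"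
    by (simp add: algebra_simps power2_eq_square)
  also have "\<dots> = of_int t ^ 2 + 2 * (of_int t + 3)" unfolding e1 e2 by simp
  finally have p2: "?x ^ 2 + ?y ^ 2 + ?z ^ 2 = of_int t ^ 2 + 2 * (of_int t + 3)" .
  have "w + \<sigma> w + \<sigma> (\<sigma> w) = 3 * a + b * (?x + ?y + ?z) + c * (?x ^ 2 + ?y ^ 2 + ?z ^ 2)"
    unfolding ss unfolding s unfolding *(4) by (simp add: algebra_simps)
  thus ?thesis unfolding e1 p2 using *(1-3) by simp
qed

lemma fixed_span_rat:
  assumes "w \<in> span_theta" and "\<sigma> w = w"
  shows "w \<in> \<rat>"
proof -
  have "3 * w \<in> \<rat>" using trace_rat[OF assms(1)] assms(2) by simp
  hence "(3 * w) / 3 \<in> \<rat>" by (intro Rats_divide) auto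
  thus ?thesis by simp
qed

lemma sigma3_span:
  assumes "w \<in> span_theta"
  shows "\<sigma> (\<sigma> (\<sigma> w)) = w"
proof -
  from assms obtain a b c where *: "a \<in> \<rat>" "b \<in> \<rat>" "c \<in> \<rat>" "w = a + b * \<theta> + c * \<theta> ^ 2"
    by (rule span_thetaE)
  thus ?thesis by (simp add: sigma_hom cubic_field_closed sigma_in sigma3_theta)
qed

text \<open>The inverse of \<open>w\<close> is the product of the other two conjugates divided by the norm, which is
  rational because it is fixed by \<open>\<sigma>\<close>.\<close>

lemma inverse_span_theta:
  assumes w: "w \<in> span_theta"
  shows "inverse w \<in> span_theta"
proof (cases "w = 0")
  case True thus ?thesis by (simp add: span_theta_rat)
next
  case False
  define N where "N = w * (\<sigma> w * \<sigma> (\<sigma> w))"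
  have adj: "\<sigma> w * \<sigma> (\<sigma> w) \<in> span_theta"
    by (intro span_theta_mult sigma_span_theta w)
  hence "N \<in> span_theta" unfolding N_def by (rule span_theta_mult[OF w])
  moreover have "\<sigma> N = N" unfolding N_def
    using sigma3_span[OF w] span_theta_in_K[OF w] by (simp add: sigma_hom sigma_in cubic_field_closed)
  ultimately have "N \<in> \<rat>" by (rule fixed_span_rat)
  have "N \<noteq> 0" unfolding N_def using False span_theta_in_K[OF w]
    by (simp add: sigma_eq_0_iff sigma_in)
  hence "inverse w = inverse N * (\<sigma> w * \<sigma> (\<sigma> w))"
    using False by (simp add: N_def field_simps)
  thus ?thesis using adj \<open>N \<in> \<rat>\<close> by (auto intro!: span_theta_mult intro: span_theta_rat)
qed

lemma K_eq_span_theta: "K = span_theta"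
proof
  show "span_theta \<subseteq> K" using span_theta_in_K by blast
  show "K \<subseteq> span_theta"
  proof
    fix w assume "w \<in> K"
    thus "w \<in> span_theta" unfolding cubic_field_def
    proof (induction rule: generate_field.induct)
      case one thus ?case by (simp add: span_theta_rat)
    next
      case (incl h) thus ?case by (auto intro: span_thetaI[of 0 1 0])
    next
      case (a_inv h)
      thus ?case using span_theta_mult[OF span_theta_rat[of "- 1"], of h] by simp
    qed (auto simp: inverse_span_theta span_theta_add span_theta_mult)
  qed
qed

text \<open>A field of degree three contains no irrational square root of a rational number: the case
  \<open>\<sigma> w = - w\<close> is excluded by \<open>\<sigma>\<close> having odd order.\<close>

lemma square_rat_imp_rat:
  assumes "w \<in> K" and "w ^ 2 \<in> \<rat>"
  shows "w \<in> \<rat>"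
proof -
  have w: "w \<in> span_theta" using assms(1) K_eq_span_theta by simp
  have "\<sigma> w ^ 2 = w ^ 2" using sigma_power[OF assms(1), of 2] sigma_rat[OF assms(2)] by simp
  hence "\<sigma> w = w \<or> \<sigma> w = - w" by (simp add: power2_eq_iff)
  thus ?thesis
  proof
    assume "\<sigma> w = w"
    thus ?thesis by (rule fixed_span_rat[OF w])
  next
    assume "\<sigma> w = - w"
    hence "\<sigma> (\<sigma> (\<sigma> w)) = - w" using sigma_uminus[OF assms(1)] by simp
    hence "w = 0" using sigma3_span[OF w] by simp
    thus ?thesis by simp
  qed
qed

text \<open>The values at \<open>e\<close> and \<open>e'\<close> of the norm identity for a trace of order two.\<close>

lemma point_trace_two_torsionE:
  assumes P: "Affine (\<theta> - 1) y \<in> curve n K" and n: "n \<in> \<rat>" "n \<noteq> 0"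
    and e: "e \<in> {0, n, - n}"  and e': "e' \<in> {0, n, - n}" "e' \<noteq> e"
    and tr: "point_trace n \<sigma> (Affine (\<theta> - 1) y) = Affine e 0"
  obtains c d where "c \<in> K" "d \<in> K"
    and "c ^ 2 * (3 * e ^ 2 - n ^ 2) = - poly (cubic t) (e + 1)"
    and "d ^ 2 * (e' - e) = poly (cubic t) (e' + 1)"
proof -
  define x0 x1 x2 where x: "x0 = \<theta> - 1" "x1 = \<sigma> x0" "x2 = \<sigma> x1"
  define y1 y2 where y: "y1 = \<sigma> y" "y2 = \<sigma> y1"
  have yK: "y \<in> K" and on0: "y ^ 2 = x0 ^ 3 - n ^ 2 * x0"
    using P by (auto simp: curve_def x)
  have xK: "x0 \<in> K" "x1 \<in> K" "x2 \<in> K" and yK': "y1 \<in> K" "y2 \<in> K"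
    using yK by (simp_all add: x y cubic_field_closed sigma_in)
  have nK: "n \<in> K" "e \<in> K" "e' \<in> K" using n e e' by (auto simp: cubic_field_closed)
  have on1: "y1 ^ 2 = x1 ^ 3 - n ^ 2 * x1"
    using arg_cong[OF on0, of \<sigma>] xK yK n
    by (simp add: x(2,3) y sigma_hom cubic_field_closed)
  have on2: "y2 ^ 2 = x2 ^ 3 - n ^ 2 * x2"
    using arg_cong[OF on1, of \<sigma>] xK yK' n
    by (simp add: x(3) y(2) sigma_hom cubic_field_closed)
  have x1: "x1 = \<sigma> \<theta> - 1" unfolding x by (simp add: sigma_hom cubic_field_closed)
  have x2: "x2 = \<sigma> (\<sigma> \<theta>) - 1" unfolding x(3) x1 by (simp add: sigma_hom cubic_field_closed sigma_in)
  have sum: "ec_add n (ec_add n (Affine x0 y) (Affine x1 y1)) (Affine x2 y2) = Affine e 0"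
    using tr by (simp add: point_trace_def x y)
  have "x0 \<noteq> x1"
  proof
    assume "x0 = x1"
    hence "\<theta> * (\<theta> + 1) = - 1" unfolding x1 sigma_theta x using theta_nonzero by (simp add: field_simps)
    moreover have "\<theta> * (\<theta> + 1) + 1 = (\<theta> + 1 / 2) ^ 2 + 3 / 4"
      by (simp add: algebra_simps power2_eq_square)
    moreover have "(\<theta> + 1 / 2) ^ 2 \<ge> 0" by simp
    ultimately show False by linarith
  qed
  have prod: "(z - x0) * (z - x1) * (z - x2) = poly (cubic t) (z + 1)" for z
    using cubic_factorization[of "z + 1"] by (simp add: x1 x2 x(1) algebra_simps)
  have "x2 + 1 \<notin> \<rat>"
    by (rule cubic_root_irrational[of t]) (simp add: prod[symmetric])
  hence "x2 \<notin> \<rat>" by (metis Rats_1 Rats_add)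
  have fac: "z ^ 3 - n ^ 2 * z = z * (z - n) * (z + n)" for z
    by (simp add: algebra_simps power2_eq_square power3_eq_cube)
  have "x2 ^ 3 \<noteq> n ^ 2 * x2"
    using fac[of x2] \<open>x2 \<notin> \<rat>\<close> n(1) by (auto simp: add_eq_0_iff)
  define l where "l = (y1 - y) / (x1 - x0)"
  define m where "m = y2 / (x2 - e)"
  define x3 where "x3 = l ^ 2 - x0 - x1"
  define d where "d = (l * (e' - x0) + y) * m / (e' - x3)"
  have es: "e ^ 3 = n ^ 2 * e" "e' ^ 3 = n ^ 2 * e'" "3 * e ^ 2 \<noteq> n ^ 2"
    using e e' fac[of e] fac[of e'] n(2) by auto
  note main = three_points_sum_two_torsion[OF on0 on1 on2 \<open>x0 \<noteq> x1\<close> \<open>x2 ^ 3 \<noteq> _\<close>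
    es(1,3,2) e'(2) sum l_def m_def x3_def d_def]
  show thesis
  proof (rule that[of "l + m" d])
    show "l + m \<in> K" "d \<in> K"
      unfolding d_def x3_def l_def m_def using xK yK yK' nK by (simp_all add: cubic_field_closed)
  qed (use main prod in simp_all)
qed

end

section \<open>Traces of order two\<close>

theorem theorem6:
  fixes n y :: real and t :: int and \<sigma> :: "real \<Rightarrow> real"
  assumes "n \<in> \<rat>" and "n > 0"
    and "t \<ge> - 1"
    and "\<sigma> \<in> galois_group (cubic_field t)" and "\<sigma> (theta t) = - 1 / (theta t + 1)"
    and "Affine (theta t - 1) y \<in> curve n (cubic_field t)"
  shows "point_trace n \<sigma> (Affine (theta t - 1) y) \<notin> two_torsion n - {Infinity}"
proof
  interpret cyclic_cubic t \<sigma> using assms(4,5) by unfold_locales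
  assume "point_trace n \<sigma> (Affine (theta t - 1) y) \<in> two_torsion n - {Infinity}"
  then obtain e where e: "e \<in> {0, n, - n}"
    and tr: "point_trace n \<sigma> (Affine (theta t - 1) y) = Affine e 0"
    by (auto simp: two_torsion_def)
  have g1: "poly (cubic t) 1 = - (2 * of_int t + 3)" by (simp add: poly_cubic)
  have g1_neg: "poly (cubic t) 1 < 0" using \<open>t \<ge> - 1\<close> unfolding g1 by linarith
  have "n \<noteq> 0" using assms(2) by simp
  note pt = point_trace_two_torsionE[OF assms(6,1) this e _ _ tr]
  from e consider "e = 0" | "e = - n" | "e = n" by blast
  thus False
  proof cases
    case 1
    obtain c where "c ^ 2 * (3 * e ^ 2 - n ^ 2) = - poly (cubic t) (e + 1)"
      by (rule pt[of n]) (use 1 \<open>n > 0\<close> in auto)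
    hence "c ^ 2 * n ^ 2 = poly (cubic t) 1" using 1 by simp
    moreover have "c ^ 2 * n ^ 2 \<ge> 0" by simp
    ultimately show False using g1_neg by linarith
  next
    case 2
    obtain d where "d ^ 2 * (0 - e) = poly (cubic t) (0 + 1)"
      by (rule pt[of 0]) (use 2 \<open>n > 0\<close> in auto)
    hence "d ^ 2 * n = poly (cubic t) 1" using 2 by simp
    moreover have "d ^ 2 * n \<ge> 0" using \<open>n > 0\<close> by simp
    ultimately show False using g1_neg by linarith
  next
    case 3
    obtain c d where cd: "c \<in> K" "d \<in> K"
      and c: "c ^ 2 * (3 * e ^ 2 - n ^ 2) = - poly (cubic t) (e + 1)"
      and d: "d ^ 2 * (0 - e) = poly (cubic t) (0 + 1)"
      by (rule pt[of 0]) (use 3 \<open>n > 0\<close> in auto)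
    have c': "2 * n ^ 2 * c ^ 2 = - poly (cubic t) (n + 1)" using c 3 by (simp add: mult_ac)
    have d': "n * d ^ 2 = 2 * of_int t + 3" using d 3 g1 by (simp add: mult_ac)
    have "d ^ 2 = (2 * of_int t + 3) / n" using d' \<open>n > 0\<close> by (simp add: field_simps)
    hence "d ^ 2 \<in> \<rat>" using \<open>n \<in> \<rat>\<close> by simp
    have "c ^ 2 = - poly (cubic t) (n + 1) / (2 * n ^ 2)"
      using c' \<open>n > 0\<close> by (simp add: field_simps)
    hence "c ^ 2 \<in> \<rat>" using \<open>n \<in> \<rat>\<close> by (simp add: poly_cubic)
    show False
      using two_descent_obstruction[OF square_rat_imp_rat square_rat_imp_rat d' c']
        cd \<open>c ^ 2 \<in> \<rat>\<close> \<open>d ^ 2 \<in> \<rat>\<close> by simp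
  qed
qed

end
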